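(* Let $P$ be a finite poset, $K$ a finite simplicial complex, $\mathsf{F}:P\to\mathsf{SubCx}(K)$ a filtration, and $\rho\ge 0$ an integer. Then, for every $(b,d)\in\mathsf{Seg}(P)$, there is an isomorphism of vector spaces $$H_0^\downarrow\mathsf{ZB}_\rho^{\mathsf{F}}((b,d))\cong\mathsf{OI}(\mathsf{ZB}_\rho^{\mathsf{F}})((b,d)).$$
   Context: Segments: $\mathsf{Seg}(P)$ consists of all pairs $(b,d)$ with $b\le d$ in $P$ (including $(a,a)$) together with a pair $(a,\infty)$ for each $a\in P$. It is ordered by the product order $(b_1,d_1)\le_\times(b_2,d_2)\iff b_1\le b_2$ and $d_1\le d_2$, where $p<\infty$ for all $p\in P$. Chains: for a finite simplicial complex $K$ over a finite totally ordered vertex set, $C_\rho^K$ is the real vector space with basis the oriented $\rho$-simplices of $K$ (oriented by the vertex order), with the inner product making this basis orthonormal, and the usual simplicial boundary operators. For a subcomplex $L\subseteq K$, $\mathsf{Z}_\rho(L)$ and $\mathsf{B}_\rho(L)$ are the $\rho$-cycles and $\rho$-boundaries of $L$, viewed as subspaces of $C_\rho^K$. $\mathsf{SubCx}(K)$ is the poset of subcomplexes of $K$ under inclusion; a filtration is an order-preserving map $\mathsf{F}:P\to\mathsf{SubCx}(K)$. Birth-death spaces: $\mathsf{ZB}_\rho^{\mathsf{F}}((b,d)) := \mathsf{Z}_\rho(\mathsf{F}(b))\cap\mathsf{B}_\rho(\mathsf{F}(d))$ for $b\le d$ in $P$, $\mathsf{ZB}_\rho^{\mathsf{F}}((b,\infty))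 := \mathsf{Z}_\rho(\mathsf{F}(b))$. With inclusions as structure maps, $\mathsf{ZB}_\rho^{\mathsf{F}}$ is a functor $(\mathsf{Seg}(P),\le_\times)\to\mathsf{Vec}$ (finite-dimensional real vector spaces). Orthogonal Inverse: $\mathsf{OI}(\mathsf{ZB}_\rho^{\mathsf{F}})((b,d)) := \mathsf{ZB}_\rho^{\mathsf{F}}((b,d))\cap\big(\sum_{(a,c)<_\times(b,d)}\mathsf{ZB}_\rho^{\mathsf{F}}((a,c))\big)^\perp$ (empty sum is $\{0\}$; $\perp$ in $C_\rho^K$). Möbius homology of a functor $N:R\to\mathsf{Vec}$, $R$ a finite poset: the order complex $\Delta R$ has as $i$-simplices the chains $a_0<\cdots<a_i$ in $R$, faces being subchains. For $r\in R$ let $\Delta R_{\le r}$ (resp. $\Delta R_{<r}$) be the subcomplex of chains whose maximal element is $\le r$ (resp. $<r$). The order cosheaf $\underline{N}$ assigns to a simplex $\sigma$ the space $N(\min\sigma)$, and to a pair $\tau\ge\sigma$ ($\sigma$ a face of $\tau$) the map $N(\min\tau\le\min\sigma)$. For a subcomplex $L\subseteq\Delta R$, $C_s(L;\underline{N}) := \bigoplus_{\sigma\in L,\dim\sigma=s}\underline{N}(\sigma)$, with boundary operator $\partial_s$ sending $x\in\underline{N}(\tau)$, $\dim\tau=s$, to $\sum_{\sigma}[\tau:\sigma]\,\underline{N}(\tau\ge\sigma)(x)$, the sum being over the codimension-one faces $\sigma$ of $\tau$ and $[\tau:\sigma]=\pm1$ the usual incidence signs for a chosen orientation of $\Delta R$.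 Then $H_s^\downarrow N(r)$ is the $s$-th homology of the relative chain complex $C_\bullet(\Delta R_{\le r};\underline{N})/C_\bullet(\Delta R_{<r};\underline{N})$. Here this is applied with $R=(\mathsf{Seg}(P),\le_\times)$, $N=\mathsf{ZB}_\rho^{\mathsf{F}}$. *)

theory Defs
  imports
    "HOL-Analysis.Analysis"
    "HOL-Analysis.Finite_Function_Topology"
    "HOL-Algebra.AbelCoset"
    "HOL-Algebra.Module"
    "HOL-Library.Extended"
    "HOL-Library.Set_Algebras"
begin

section \<open>Real vector spaces with a carrier, quotients and homology\<close>

text \<open>
  Quotients are taken in the module records of HOL-Algebra. A module record extends a ring record;
  its ring multiplication and unit play no role for modules and are left undefined here.
\<close>

definition subspace_module :: "'w::real_vector set \<Rightarrow> (real, 'w) module" where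
  "subspace_module V =
     \<lparr>carrier = V, mult = undefined, one = undefined, zero = 0, add = (+), smult = (*\<^sub>R)\<rparr>"

definition quot_module :: "(real, 'w) module \<Rightarrow> 'w set \<Rightarrow> (real, 'w set) module" where
  "quot_module M N =
     \<lparr>carrier = a_rcosets\<^bsub>M\<^esub> N, mult = undefined, one = undefined, zero = N, add = set_add M,
      smult = (\<lambda>c A. \<Union>a\<in>A. N +>\<^bsub>M\<^esub> (c \<odot>\<^bsub>M\<^esub> a))\<rparr>"

text \<open>The map into \<open>M' / N'\<close> induced on cosets by \<open>f\<close>.\<close>

definition quot_map :: "(real, 'w) module \<Rightarrow> 'w set \<Rightarrow> ('v \<Rightarrow> 'w) \<Rightarrow> 'v set \<Rightarrow> 'w set" where
  "quot_map M' N' f A = (\<Union>a\<in>A. N' +>\<^bsub>M'\<^esub> f a)"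

definition homology_at ::
  "(real, 'a) module \<Rightarrow> ('a \<Rightarrow> 'b) \<Rightarrow> (real, 'b) module \<Rightarrow> ('b \<Rightarrow> 'c) \<Rightarrow> (real, 'c) module
     \<Rightarrow> (real, 'b set) module" where
  "homology_at A f B g C = quot_module (B\<lparr>carrier := a_kernel B C g\<rparr>) (f ` carrier A)"

definition vs_isomorphic :: "(real, 'a) module \<Rightarrow> (real, 'b) module \<Rightarrow> bool" where
  "vs_isomorphic M N \<longleftrightarrow>
     (\<exists>f \<in> iso (add_monoid M) (add_monoid N).
        \<forall>c. \<forall>x\<in>carrier M. f (c \<odot>\<^bsub>M\<^esub> x) = c \<odot>\<^bsub>N\<^esub> f x)"


section \<open>Simplicial chains\<close>

definition finite_complex :: "'v set set \<Rightarrow> bool" where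
  "finite_complex K \<longleftrightarrow>
     finite K \<and> (\<forall>\<sigma>\<in>K. finite \<sigma> \<and> \<sigma> \<noteq> {} \<and> (\<forall>\<tau>. \<tau> \<subseteq> \<sigma> \<and> \<tau> \<noteq> {} \<longrightarrow> \<tau> \<in> K))"

definition SubCx :: "'v set set \<Rightarrow> 'v set set set" where
  "SubCx K = {L. L \<subseteq> K \<and> finite_complex L}"

definition filtration :: "'p::order set \<Rightarrow> 'v set set \<Rightarrow> ('p \<Rightarrow> 'v set set) \<Rightarrow> bool" where
  "filtration P K F \<longleftrightarrow> F \<in> P \<rightarrow> SubCx K \<and> mono_on P F"

text \<open>
  The sign \<open>(-1)^i\<close> with which the facet omitting \<open>v\<close>, the \<open>i\<close>-th vertex of \<open>\<sigma>\<close> in increasing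
  order (counted from 0), occurs in the boundary of \<open>\<sigma>\<close>, both oriented by the vertex order.
\<close>

definition face_sign :: "'v::order set \<Rightarrow> 'v \<Rightarrow> real" where
  "face_sign \<sigma> v = (-1) ^ card {u\<in>\<sigma>. u < v}"

definition simplicial_chains :: "nat \<Rightarrow> 'v set set \<Rightarrow> ('v set \<Rightarrow>\<^sub>0 real) set" where
  "simplicial_chains \<rho> L = {c. Poly_Mapping.keys c \<subseteq> {\<sigma>\<in>L. card \<sigma> = Suc \<rho>}}"

text \<open>Homology is unreduced, so the empty face of a vertex is left out.\<close>

definition simplicial_boundary :: "('v::linorder set \<Rightarrow>\<^sub>0 real) \<Rightarrow> ('v set \<Rightarrow>\<^sub>0 real)" where
  "simplicial_boundary c =
     (\<Sum>\<sigma>\<in>Poly_Mapping.keys c. \<Sum>v\<in>{v\<in>\<sigma>. \<sigma> - {v} \<noteq> {}}.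
        Poly_Mapping.single (\<sigma> - {v}) (face_sign \<sigma> v * Poly_Mapping.lookup c \<sigma>))"

definition cycles :: "nat \<Rightarrow> 'v::linorder set set \<Rightarrow> ('v set \<Rightarrow>\<^sub>0 real) set" where
  "cycles \<rho> L = {c \<in> simplicial_chains \<rho> L. simplicial_boundary c = 0}"

definition boundaries :: "nat \<Rightarrow> 'v::linorder set set \<Rightarrow> ('v set \<Rightarrow>\<^sub>0 real) set" where
  "boundaries \<rho> L = simplicial_boundary ` simplicial_chains (Suc \<rho>) L"

definition chain_inner :: "('s \<Rightarrow>\<^sub>0 real) \<Rightarrow> ('s \<Rightarrow>\<^sub>0 real) \<Rightarrow> real" where
  "chain_inner x y =
     (\<Sum>\<sigma>\<in>Poly_Mapping.keys x. Poly_Mapping.lookup x \<sigma> * Poly_Mapping.lookup y \<sigma>)"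

definition chain_orth_comp ::
  "nat \<Rightarrow> 'v set set \<Rightarrow> ('v set \<Rightarrow>\<^sub>0 real) set \<Rightarrow> ('v set \<Rightarrow>\<^sub>0 real) set" where
  "chain_orth_comp \<rho> K W = {x \<in> simplicial_chains \<rho> K. \<forall>y\<in>W. chain_inner x y = 0}"


section \<open>Segments, birth-death spaces and their orthogonal inverse\<close>

text \<open>
  The point at infinity is \<^const>\<open>Pinf\<close>; the bottom element \<^const>\<open>Minf\<close> of \<^typ>\<open>'p extended\<close>
  never occurs in a segment. The order on pairs is the product order of
  \<^theory>\<open>HOL-Library.Product_Order\<close>.
\<close>

definition Seg :: "'p::order set \<Rightarrow> ('p \<times> 'p extended) set" where
  "Seg P = {(b, Fin d) | b d. b \<in> P \<and> d \<in> P \<and> b \<le> d} \<union> {(a, Pinf) | a. a \<in> P}"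

fun ZB :: "nat \<Rightarrow> ('p \<Rightarrow> 'v::linorder set set) \<Rightarrow> 'p \<times> 'p extended \<Rightarrow> ('v set \<Rightarrow>\<^sub>0 real) set" where
  "ZB \<rho> F (b, Fin d) = cycles \<rho> (F b) \<inter> boundaries \<rho> (F d)"
| "ZB \<rho> F (b, Pinf) = cycles \<rho> (F b)"

text \<open>The sum below is the sum of subspaces: addition of sets is elementwise, and \<open>0 = {0}\<close>.\<close>

definition orth_inverse ::
  "'p::order set \<Rightarrow> 'v::linorder set set \<Rightarrow> nat \<Rightarrow> ('p \<Rightarrow> 'v set set)
     \<Rightarrow> 'p \<times> 'p extended \<Rightarrow> ('v set \<Rightarrow>\<^sub>0 real) set" where
  "orth_inverse P K \<rho> F s =
     ZB \<rho> F s \<inter> chain_orth_comp \<rho> K (\<Sum>t\<in>{t \<in> Seg P. t < s}. ZB \<rho> F t)"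


section \<open>Moebius homology\<close>

text \<open>
  A functor from a poset \<open>R\<close> to vector spaces is given by subspaces \<open>N r\<close> of an ambient space
  and structure maps \<open>\<phi> r r' : N r \<rightarrow> N r'\<close> for \<open>r \<le> r'\<close>.
\<close>

definition order_complex :: "'r::order set \<Rightarrow> 'r set set" where
  "order_complex R = {\<sigma>. \<sigma> \<subseteq> R \<and> finite \<sigma> \<and> \<sigma> \<noteq> {} \<and> (\<forall>a\<in>\<sigma>. \<forall>b\<in>\<sigma>. a \<le> b \<or> b \<le> a)}"

definition chain_min :: "'r::order set \<Rightarrow> 'r" where
  "chain_min \<sigma> = (LEAST a. a \<in> \<sigma>)"

definition chain_max :: "'r::order set \<Rightarrow> 'r" where
  "chain_max \<sigma> = (GREATEST a. a \<in> \<sigma>)"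

definition order_complex_le :: "'r::order set \<Rightarrow> 'r \<Rightarrow> 'r set set" where
  "order_complex_le R r = {\<sigma> \<in> order_complex R. chain_max \<sigma> \<le> r}"

definition order_complex_less :: "'r::order set \<Rightarrow> 'r \<Rightarrow> 'r set set" where
  "order_complex_less R r = {\<sigma> \<in> order_complex R. chain_max \<sigma> < r}"

text \<open>
  An orientation is recorded by comparing it with the orientation of each chain in increasing
  order: \<open>\<epsilon> \<sigma> = 1\<close> if they agree on \<open>\<sigma>\<close>, and \<open>\<epsilon> \<sigma> = -1\<close> otherwise.
\<close>

definition orientation :: "'r set set \<Rightarrow> ('r set \<Rightarrow> real) \<Rightarrow> bool" where
  "orientation X \<epsilon> \<longleftrightarrow> \<epsilon> \<in> X \<rightarrow> {1, -1}"

text \<open>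
  Degrees are integers, so that the term in degree \<open>-1\<close> of the complex is the zero space
  (it would otherwise be truncated to degree \<open>0\<close>).
\<close>

definition cosheaf_chains ::
  "('r::order \<Rightarrow> 'w::real_vector set) \<Rightarrow> 'r set set \<Rightarrow> int \<Rightarrow> ('r set \<Rightarrow>\<^sub>0 'w) set" where
  "cosheaf_chains N L s =
     {c. Poly_Mapping.keys c \<subseteq> {\<sigma>\<in>L. int (card \<sigma>) = s + 1} \<and>
         (\<forall>\<sigma>\<in>Poly_Mapping.keys c. Poly_Mapping.lookup c \<sigma> \<in> N (chain_min \<sigma>))}"

definition cosheaf_boundary ::
  "('r::order \<Rightarrow> 'r \<Rightarrow> 'w::real_vector \<Rightarrow> 'w) \<Rightarrow> ('r set \<Rightarrow> real) \<Rightarrow> ('r set \<Rightarrow>\<^sub>0 'w) \<Rightarrow> ('r set \<Rightarrow>\<^sub>0 'w)"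
  where
  "cosheaf_boundary \<phi> \<epsilon> c =
     (\<Sum>\<tau>\<in>Poly_Mapping.keys c. \<Sum>a\<in>{a\<in>\<tau>. \<tau> - {a} \<noteq> {}}.
        Poly_Mapping.single (\<tau> - {a})
          ((\<epsilon> \<tau> * \<epsilon> (\<tau> - {a}) * face_sign \<tau> a) *\<^sub>R
             \<phi> (chain_min \<tau>) (chain_min (\<tau> - {a})) (Poly_Mapping.lookup c \<tau>)))"

definition rel_chains ::
  "'r::order set \<Rightarrow> ('r \<Rightarrow> 'w::real_vector set) \<Rightarrow> 'r \<Rightarrow> int \<Rightarrow> (real, ('r set \<Rightarrow>\<^sub>0 'w) set) module"
  where
  "rel_chains R N r s =
     quot_module (subspace_module (cosheaf_chains N (order_complex_le R r) s))
       (cosheaf_chains N (order_complex_less R r) s)"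

definition rel_boundary ::
  "'r::order set \<Rightarrow> ('r \<Rightarrow> 'w::real_vector set) \<Rightarrow> ('r \<Rightarrow> 'r \<Rightarrow> 'w \<Rightarrow> 'w) \<Rightarrow> ('r set \<Rightarrow> real)
     \<Rightarrow> 'r \<Rightarrow> int \<Rightarrow> ('r set \<Rightarrow>\<^sub>0 'w) set \<Rightarrow> ('r set \<Rightarrow>\<^sub>0 'w) set"
  where
  "rel_boundary R N \<phi> \<epsilon> r s =
     quot_map (subspace_module (cosheaf_chains N (order_complex_le R r) (s - 1)))
       (cosheaf_chains N (order_complex_less R r) (s - 1)) (cosheaf_boundary \<phi> \<epsilon>)"

definition moebius_homology ::
  "'r::order set \<Rightarrow> ('r \<Rightarrow> 'w::real_vector set) \<Rightarrow> ('r \<Rightarrow> 'r \<Rightarrow> 'w \<Rightarrow> 'w) \<Rightarrow> ('r set \<Rightarrow> real)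
     \<Rightarrow> int \<Rightarrow> 'r \<Rightarrow> (real, ('r set \<Rightarrow>\<^sub>0 'w) set set) module"
  where
  "moebius_homology R N \<phi> \<epsilon> s r =
     homology_at
       (rel_chains R N r (s + 1)) (rel_boundary R N \<phi> \<epsilon> r (s + 1))
       (rel_chains R N r s) (rel_boundary R N \<phi> \<epsilon> r s)
       (rel_chains R N r (s - 1))"

text \<open>The structure maps of \<^const>\<open>ZB\<close>: inclusions of subspaces of one chain space.\<close>

definition inclusion_maps :: "'r \<Rightarrow> 'r \<Rightarrow> 'w \<Rightarrow> 'w" where
  "inclusion_maps r r' = (\<lambda>x. x)"

end

theory Submission
  imports Defs
begin

text \<open>
  Let \<open>N\<close> be a functor from a finite poset to subspaces of one vector space, with inclusions as
  structure maps, and let \<open>S\<close> be the sum of the spaces \<open>N t\<close> over \<open>t < r\<close>. In degree 0 the chains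
  relative to the part below \<open>r\<close> are supported on the single vertex \<open>r\<close>, so the coefficient at
  \<open>r\<close> identifies them with \<open>N r\<close> (\<open>linear_surjection_coefficient_at_top\<close>,
  \<open>vertex_chains_less_eq\<close>). They are all cycles. The boundary of an edge \<open>t < r\<close> with coefficient
  \<open>x\<close> in \<open>N t\<close> has coefficient \<open>\<plusminus>x\<close> at \<open>r\<close>, and edges not ending in \<open>r\<close> contribute nothing there.
  The relative boundaries therefore correspond exactly to \<open>S\<close> (\<open>edge_boundary_at_top\<close>,
  \<open>generated_below_is_edge_boundary\<close>), the homology is \<open>N r / S\<close>, and every linear complement of
  \<open>S\<close> in \<open>N r\<close> is isomorphic to it (\<open>moebius_homology_0_complement\<close>).

  Birth-death spaces form such a functor, and their orthogonal inverse is the intersection of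
  \<open>N r\<close> with the orthogonal complement of \<open>S\<close>. Since the chain space is finite-dimensional,
  every element of \<open>N r\<close> has an orthogonal projection to \<open>S\<close> (\<open>orthogonal_decomposition\<close>), and
  this intersection is a complement.
\<close>

section \<open>Quotients by kernels\<close>

text \<open>
  Formulated over the additive groups, so that the homomorphism theorem for groups supplies the
  isomorphism and only its compatibility with scalars has to be added.
\<close>

definition linear_surjection ::
  "(real, 'a) module \<Rightarrow> (real, 'b) module \<Rightarrow> ('a \<Rightarrow> 'b) \<Rightarrow> bool" where
  "linear_surjection M M' h \<longleftrightarrow>
     group_hom (add_monoid M) (add_monoid M') h \<and> h ` carrier M = carrier M' \<and>
     (\<forall>c. \<forall>x\<in>carrier M. c \<odot>\<^bsub>M\<^esub> x \<in> carrier M \<and> h (c \<odot>\<^bsub>M\<^esub> x) = c \<odot>\<^bsub>M'\<^esub> h x)"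

lemma vs_isomorphic_if_injective_linear_surjection:
  assumes "linear_surjection M M' h" and "inj_on h (carrier M)"
  shows "vs_isomorphic M M'"
  using assms unfolding vs_isomorphic_def linear_surjection_def group_hom_def group_hom_axioms_def
  by (intro bexI[of _ h]) (simp_all add: iso_def bij_betw_def)

lemma linear_surjection_comp:
  assumes "linear_surjection M M' h" and "linear_surjection M' M'' k"
  shows "linear_surjection M M'' (k \<circ> h)"
proof -
  have "h x \<in> carrier M'" if "x \<in> carrier M" for x
    using assms(1) that by (auto simp: linear_surjection_def)
  moreover have "(k \<circ> h) ` carrier M = carrier M''"
    using assms by (simp only: linear_surjection_def image_comp[symmetric])
  moreover have "k \<circ> h \<in> hom (add_monoid M) (add_monoid M'')"
    using assms hom_compose
    by (fastforce simp only: linear_surjection_def group_hom_def group_hom_axioms_def)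
  ultimately show ?thesis
    using assms by (simp add: linear_surjection_def group_hom_def group_hom_axioms_def)
qed

text \<open>
  A quotient module carries the group structure of a factor group, but the two records differ in
  their extension fields. Hence they are compared through the properties that do not see these.
\<close>

lemma group_quot_module:
  "group (add_monoid (quot_module M N)) \<longleftrightarrow> group (add_monoid M Mod N)"
  by (simp add: group_def group_axioms_def monoid_def Units_def quot_module_def FactGroup_def
      A_RCOSETS_def set_add_def)

lemma iso_quot_module:
  "iso (add_monoid (quot_module M N)) H = iso (add_monoid M Mod N) H"
  by (simp add: iso_def hom_def quot_module_def FactGroup_def A_RCOSETS_def set_add_def)

text \<open>
  The homomorphism theorem, in a form that can be iterated: the induced map on the quotient is
  again a linear surjection, and it is evaluated on a coset at any representative.
\<close>

lemma linear_surjection_quot_kernel: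
  assumes h: "linear_surjection M M' h"
    and N: "N = {x \<in> carrier M. h x = \<zero>\<^bsub>M'\<^esub>}"
  shows "linear_surjection (quot_module M N) M' (\<lambda>X. the_elem (h ` X))"
    and "inj_on (\<lambda>X. the_elem (h ` X)) (carrier (quot_module M N))"
    and "\<And>a. a \<in> carrier M \<Longrightarrow> the_elem (h ` (N +>\<^bsub>M\<^esub> a)) = h a"
proof -
  interpret H: group_hom "add_monoid M" "add_monoid M'" h
    using h by (simp add: linear_surjection_def)
  have N': "N = kernel (add_monoid M) (add_monoid M') h"
    by (simp add: N kernel_def)
  have iso: "(\<lambda>X. the_elem (h ` X)) \<in> iso (add_monoid (quot_module M N)) (add_monoid M')"
    using H.FactGroup_iso_set h unfolding iso_quot_module N'
    by (simp add: linear_surjection_def)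
  then show "inj_on (\<lambda>X. the_elem (h ` X)) (carrier (quot_module M N))"
    by (auto simp: iso_def bij_betw_def)
  have coset: "x \<in> carrier M \<and> h x = h a" if x: "x \<in> N +>\<^bsub>M\<^esub> a" and a: "a \<in> carrier M" for x a
  proof -
    obtain n where n: "n \<in> N" "x = n \<oplus>\<^bsub>M\<^esub> a"
      using x by (auto simp: a_r_coset_def r_coset_def)
    then have "n \<in> carrier M" "h n = \<zero>\<^bsub>M'\<^esub>"
      by (simp_all add: N)
    then show ?thesis
      using H.hom_mult[of n a] H.G.m_closed[of n a] H.H.l_one[of "h a"] H.hom_closed[of a] n a
      by simp
  qed
  have self: "a \<in> N +>\<^bsub>M\<^esub> a" if "a \<in> carrier M" for a
    using H.G.rcos_self[OF _ H.subgroup_kernel] that by (simp add: a_r_coset_def N')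
  show map_coset: "the_elem (h ` (N +>\<^bsub>M\<^esub> a)) = h a" if "a \<in> carrier M" for a
  proof -
    have "h ` (N +>\<^bsub>M\<^esub> a) = {h a}"
      using coset self that by blast
    then show ?thesis by simp
  qed
  have "c \<odot>\<^bsub>quot_module M N\<^esub> X \<in> carrier (quot_module M N) \<and>
      the_elem (h ` (c \<odot>\<^bsub>quot_module M N\<^esub> X)) = c \<odot>\<^bsub>M'\<^esub> the_elem (h ` X)"
    if X: "X \<in> carrier (quot_module M N)" for c X
  proof -
    obtain a where a: "a \<in> carrier M" "X = N +>\<^bsub>M\<^esub> a"
      using X by (auto simp: quot_module_def A_RCOSETS_def')
    have sc: "c \<odot>\<^bsub>M\<^esub> x \<in> carrier M" "h (c \<odot>\<^bsub>M\<^esub> x) = c \<odot>\<^bsub>M'\<^esub> h x" if "x \<in> carrier M" for x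
      using h that by (auto simp: linear_surjection_def)
    have "N +>\<^bsub>M\<^esub> (c \<odot>\<^bsub>M\<^esub> x) = N +>\<^bsub>M\<^esub> (c \<odot>\<^bsub>M\<^esub> a)" if "x \<in> X" for x
    proof -
      have "x \<in> carrier M" "h x = h a"
        using coset[of x a] that a by auto
      then have "h (c \<odot>\<^bsub>M\<^esub> x) = h (c \<odot>\<^bsub>M\<^esub> a)"
        using sc a by simp
      then show ?thesis
        using sc(1)[OF \<open>x \<in> carrier M\<close>] sc(1)[OF a(1)] unfolding a_r_coset_def N'
        by (intro equalityI H.FactGroup_subset) simp_all
    qed
    then have "(\<Union>x\<in>X. N +>\<^bsub>M\<^esub> (c \<odot>\<^bsub>M\<^esub> x)) = (\<Union>x\<in>X. N +>\<^bsub>M\<^esub> (c \<odot>\<^bsub>M\<^esub> a))"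
      by (intro SUP_cong refl)
    moreover have "X \<noteq> {}"
      using self[OF a(1)] a(2) by auto
    ultimately have "c \<odot>\<^bsub>quot_module M N\<^esub> X = N +>\<^bsub>M\<^esub> (c \<odot>\<^bsub>M\<^esub> a)"
      by (simp add: quot_module_def)
    then show ?thesis
      using a sc map_coset by (auto simp: quot_module_def A_RCOSETS_def')
  qed
  moreover have "group (add_monoid (quot_module M N))"
    unfolding group_quot_module N' by (rule normal.factorgroup_is_group[OF H.normal_kernel])
  ultimately show "linear_surjection (quot_module M N) M' (\<lambda>X. the_elem (h ` X))"
    using iso H.H.is_group unfolding linear_surjection_def group_hom_def group_hom_axioms_def
    by (auto simp: iso_def bij_betw_def)
qed

lemma subspace_module_simps [simp]:
  "carrier (subspace_module V) = V" "zero (subspace_module V) = 0"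
  "add (subspace_module V) = (+)" "smult (subspace_module V) = (*\<^sub>R)"
  by (simp_all add: subspace_module_def)

lemma group_subspace_module:
  assumes "subspace V"
  shows "group (add_monoid (subspace_module V))"
proof (rule groupI)
  fix x
  assume "x \<in> carrier (add_monoid (subspace_module V))"
  then show "\<exists>y\<in>carrier (add_monoid (subspace_module V)).
      y \<otimes>\<^bsub>add_monoid (subspace_module V)\<^esub> x = \<one>\<^bsub>add_monoid (subspace_module V)\<^esub>"
    using subspace_neg[OF assms] by (intro bexI[of _ "- x"]) simp_all
qed (use assms in \<open>simp_all add: subspace_add subspace_0 add.assoc\<close>)

lemma linear_surjection_subspace_module:
  assumes "subspace V" "subspace W" "h ` V = W"
    and "\<And>x y. x \<in> V \<Longrightarrow> y \<in> V \<Longrightarrow> h (x + y) = h x + h y"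
    and "\<And>c x. x \<in> V \<Longrightarrow> h (c *\<^sub>R x) = c *\<^sub>R h x"
  shows "linear_surjection (subspace_module V) (subspace_module W) h"
  using assms group_subspace_module[OF assms(1)] group_subspace_module[OF assms(2)]
  unfolding linear_surjection_def group_hom_def group_hom_axioms_def
  by (auto simp: hom_def subspace_scale)

lemma coset_subspace_module: "N +>\<^bsub>subspace_module V\<^esub> a = (\<lambda>n. n + a) ` N"
  by (auto simp: a_r_coset_def r_coset_def)

lemma carrier_quot_subspace_module:
  "carrier (quot_module (subspace_module V) N) = (\<lambda>a. (\<lambda>n. n + a) ` N) ` V"
  by (auto simp: quot_module_def A_RCOSETS_def' coset_subspace_module)

text \<open>
  The union over all representatives that defines the induced map collapses to one coset, because
  two representatives have images that differ by an element of \<open>N'\<close>.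
\<close>

lemma quot_map_coset:
  assumes "subspace N" "subspace N'" "f ` N \<subseteq> N'" "linear f"
  shows "quot_map (subspace_module V') N' f ((\<lambda>n. n + a) ` N) = (\<lambda>n. n + f a) ` N'"
proof -
  have "(\<lambda>n. n + f (m + a)) ` N' = (\<lambda>n. n + f a) ` N'" if "m \<in> N" for m
  proof -
    have m: "f m \<in> N'" using that assms by auto
    have "f (m + a) = f m + f a"
      using assms(4) by (rule linear_add)
    moreover have "(\<lambda>n. n + f m) ` N' = N'"
    proof
      show "N' \<subseteq> (\<lambda>n. n + f m) ` N'"
        using subspace_diff[OF assms(2) _ m] by (force intro: image_eqI[of _ _ "_ - f m"])
    qed (use subspace_add[OF assms(2) _ m] in auto)
    then have "(\<lambda>n. n + f a) ` N' = (\<lambda>n. n + f a) ` (\<lambda>n. n + f m) ` N'"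
      by simp
    ultimately show ?thesis
      by (simp add: image_image add.assoc)
  qed
  moreover have "0 \<in> N" using assms(1) by (rule subspace_0)
  ultimately show ?thesis
    unfolding quot_map_def coset_subspace_module by fastforce
qed

section \<open>Linear maps on finitely supported functions and sums of subspaces\<close>

lemma lookup_scaleR:
  "Poly_Mapping.lookup (k *\<^sub>R c) \<sigma> = k *\<^sub>R Poly_Mapping.lookup c \<sigma>"
proof -
  have "finite {i. k *\<^sub>R Poly_Mapping.lookup c i \<noteq> 0}"
    by (rule finite_subset[OF _ finite_keys[of c]]) (auto simp: in_keys_iff)
  then show ?thesis
    by (simp add: scaleR_poly_mapping_def)
qed

text \<open>
  Both boundary operators and the inner product are sums over the support of their argument.
  Linearity is not immediate, since the support changes under addition; it follows because each
  sum may be extended to a larger finite set on which the extra terms vanish.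
\<close>

lemma linear_sum_over_keys:
  fixes G :: "'a \<Rightarrow> 'b::real_vector \<Rightarrow> 'c::real_vector"
  assumes G: "\<And>\<sigma>. linear (G \<sigma>)"
  shows "linear (\<lambda>c. \<Sum>\<sigma>\<in>Poly_Mapping.keys c. G \<sigma> (Poly_Mapping.lookup c \<sigma>))"
proof -
  have ext: "(\<Sum>\<sigma>\<in>Poly_Mapping.keys c. G \<sigma> (Poly_Mapping.lookup c \<sigma>))
      = (\<Sum>\<sigma>\<in>A. G \<sigma> (Poly_Mapping.lookup c \<sigma>))"
    if "finite A" "Poly_Mapping.keys c \<subseteq> A" for c A
    using that linear_0[OF G] by (intro sum.mono_neutral_left) (auto simp: in_keys_iff)
  show ?thesis
  proof (rule linearI)
    fix c d :: "'a \<Rightarrow>\<^sub>0 'b" and k :: real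
    let ?A = "Poly_Mapping.keys c \<union> Poly_Mapping.keys d"
    have finite_A: "finite ?A" by simp
    show "(\<Sum>\<sigma>\<in>Poly_Mapping.keys (c + d). G \<sigma> (Poly_Mapping.lookup (c + d) \<sigma>)) =
      (\<Sum>\<sigma>\<in>Poly_Mapping.keys c. G \<sigma> (Poly_Mapping.lookup c \<sigma>)) +
      (\<Sum>\<sigma>\<in>Poly_Mapping.keys d. G \<sigma> (Poly_Mapping.lookup d \<sigma>))"
      unfolding ext[of ?A "c + d", OF finite_A Poly_Mapping.keys_add]
      by (simp only: ext[of ?A c, OF finite_A Un_upper1] ext[of ?A d, OF finite_A Un_upper2]
          lookup_add linear_add[OF G] sum.distrib)
    have "Poly_Mapping.keys (k *\<^sub>R c) \<subseteq> Poly_Mapping.keys c"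
      by (auto simp: in_keys_iff lookup_scaleR)
    then show "(\<Sum>\<sigma>\<in>Poly_Mapping.keys (k *\<^sub>R c). G \<sigma> (Poly_Mapping.lookup (k *\<^sub>R c) \<sigma>)) =
      k *\<^sub>R (\<Sum>\<sigma>\<in>Poly_Mapping.keys c. G \<sigma> (Poly_Mapping.lookup c \<sigma>))"
      unfolding ext[OF finite_keys \<open>Poly_Mapping.keys (k *\<^sub>R c) \<subseteq> Poly_Mapping.keys c\<close>]
      by (simp add: lookup_scaleR linear_scale[OF G] scaleR_sum_right)
  qed
qed

lemma single_scaleR: "Poly_Mapping.single \<sigma> (k *\<^sub>R x) = k *\<^sub>R Poly_Mapping.single \<sigma> x"
  by (rule poly_mapping_eqI) (simp add: lookup_scaleR lookup_single when_def)

lemma linear_single: "linear (Poly_Mapping.single \<sigma>)"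
  by (rule linearI) (simp_all add: single_add single_scaleR)

lemma linear_cosheaf_boundary: "linear (cosheaf_boundary inclusion_maps \<epsilon>)"
proof -
  have "linear (\<lambda>x. \<Sum>a\<in>{a\<in>\<tau>. \<tau> - {a} \<noteq> {}}.
      Poly_Mapping.single (\<tau> - {a}) ((\<epsilon> \<tau> * \<epsilon> (\<tau> - {a}) * face_sign \<tau> a) *\<^sub>R x))" for \<tau>
    by (intro linear_compose_sum ballI linear_compose[OF _ linear_single, unfolded o_def]
        linear_scale_self)
  from linear_sum_over_keys[OF this] show ?thesis
    by (simp add: cosheaf_boundary_def[abs_def] inclusion_maps_def)
qed

lemma linear_simplicial_boundary: "linear simplicial_boundary"
proof -
  have "linear (\<lambda>x. \<Sum>v\<in>{v\<in>\<sigma>. \<sigma> - {v} \<noteq> {}}.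
      Poly_Mapping.single (\<sigma> - {v}) (face_sign \<sigma> v * x))" for \<sigma> :: "'v::linorder set"
    by (intro linear_compose_sum ballI linear_compose[OF _ linear_single, unfolded o_def]
        linear_times)
  from linear_sum_over_keys[OF this] show ?thesis
    by (simp add: simplicial_boundary_def[abs_def])
qed

lemma subspace_sum_of_subspaces:
  assumes "finite I" "\<And>i. i \<in> I \<Longrightarrow> subspace (V i)"
  shows "subspace (\<Sum>i\<in>I. V i)"
proof (rule subspaceI)
  note alt = set_sum_alt[OF assms(1), of V]
  show "0 \<in> (\<Sum>i\<in>I. V i)"
    unfolding alt using subspace_0[OF assms(2)] by (force intro!: exI[of _ "\<lambda>_. 0"])
  fix x y and k :: real
  assume "x \<in> (\<Sum>i\<in>I. V i)"
  then obtain s where s: "x = sum s I" "\<forall>i\<in>I. s i \<in> V i" unfolding alt by auto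
  then show "k *\<^sub>R x \<in> (\<Sum>i\<in>I. V i)"
    unfolding alt using subspace_scale[OF assms(2)]
    by (auto simp: scaleR_sum_right intro!: exI[of _ "\<lambda>i. k *\<^sub>R s i"])
  assume "y \<in> (\<Sum>i\<in>I. V i)"
  then obtain t where t: "y = sum t I" "\<forall>i\<in>I. t i \<in> V i" unfolding alt by auto
  show "x + y \<in> (\<Sum>i\<in>I. V i)"
    unfolding alt using s t subspace_add[OF assms(2)]
    by (auto simp: sum.distrib intro!: exI[of _ "\<lambda>i. s i + t i"])
qed

lemma sum_of_subspaces_subset:
  assumes "finite I" "subspace W" "\<And>i. i \<in> I \<Longrightarrow> V i \<subseteq> W"
  shows "(\<Sum>i\<in>I. V i) \<subseteq> W"
  using assms(3) by (auto simp: set_sum_alt[OF assms(1)] intro!: subspace_sum[OF assms(2)])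

lemma summand_subset_sum_of_subspaces:
  assumes "finite I" "\<And>i. i \<in> I \<Longrightarrow> subspace (V i)" "i \<in> I"
  shows "V i \<subseteq> (\<Sum>i\<in>I. V i)"
proof
  fix x assume "x \<in> V i"
  then show "x \<in> (\<Sum>i\<in>I. V i)"
    using assms subspace_0[OF assms(2)] unfolding set_sum_alt[OF assms(1)]
    by (auto intro!: exI[of _ "\<lambda>j. if j = i then x else 0"])
qed

text \<open>
  The projection onto \<open>Q\<close> along \<open>S\<close> sends \<open>x\<close> to the \<open>q\<close> in \<open>Q\<close> with \<open>x - q\<close> in \<open>S\<close>, which is
  unique as \<open>Q\<close> and \<open>S\<close> meet only in 0; uniqueness gives linearity.
\<close>

lemma projection_along:
  assumes V: "subspace V" and Q: "subspace Q" "Q \<subseteq> V" and S: "subspace S"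
    and disjoint: "Q \<inter> S = {0}" and split: "\<And>x. x \<in> V \<Longrightarrow> \<exists>q\<in>Q. x - q \<in> S"
  obtains \<pi> where "linear_surjection (subspace_module V) (subspace_module Q) \<pi>"
    and "\<And>x. x \<in> V \<Longrightarrow> \<pi> x = 0 \<longleftrightarrow> x \<in> S"
proof -
  define \<pi> where "\<pi> x = (SOME q. q \<in> Q \<and> x - q \<in> S)" for x
  have \<pi>: "\<pi> x \<in> Q \<and> x - \<pi> x \<in> S" if "x \<in> V" for x
    unfolding \<pi>_def by (rule someI_ex) (use split[OF that] in auto)
  have unique: "\<pi> x = q" if "x \<in> V" "q \<in> Q" "x - q \<in> S" for x q
  proof -
    have "\<pi> x - q \<in> Q" using \<pi> that Q by (simp add: subspace_diff)
    moreover have "\<pi> x - q \<in> S"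
      using subspace_diff[OF S, of "x - q" "x - \<pi> x"] \<pi> that by simp
    ultimately have "\<pi> x - q \<in> Q \<inter> S" by (rule IntI)
    then show ?thesis unfolding disjoint by simp
  qed
  have "\<pi> (x + y) = \<pi> x + \<pi> y" if "x \<in> V" "y \<in> V" for x y
  proof (rule unique)
    show "x + y - (\<pi> x + \<pi> y) \<in> S"
      using subspace_add[OF S, of "x - \<pi> x" "y - \<pi> y"] \<pi> that by (simp add: algebra_simps)
  qed (use \<pi> that V Q in \<open>auto simp: subspace_add\<close>)
  moreover have "\<pi> (c *\<^sub>R x) = c *\<^sub>R \<pi> x" if "x \<in> V" for c x
  proof (rule unique)
    show "c *\<^sub>R x - c *\<^sub>R \<pi> x \<in> S"
      using subspace_scale[OF S, of "x - \<pi> x" c] \<pi> that by (simp add: scaleR_diff_right)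
  qed (use \<pi> that V Q in \<open>auto simp: subspace_scale\<close>)
  moreover have "\<pi> ` V = Q"
  proof
    show "Q \<subseteq> \<pi> ` V"
    proof
      fix q assume "q \<in> Q"
      then show "q \<in> \<pi> ` V"
        using unique[of q q] Q(2) subspace_0[OF S] by (intro image_eqI[of _ _ q]) auto
    qed
  qed (use \<pi> in auto)
  ultimately have "linear_surjection (subspace_module V) (subspace_module Q) \<pi>"
    by (intro linear_surjection_subspace_module V Q)
  moreover have "\<pi> x = 0 \<longleftrightarrow> x \<in> S" if "x \<in> V" for x
    using \<pi>[OF that] unique[OF that, of 0] subspace_0[OF Q(1)] by auto
  ultimately show ?thesis using that by blast
qed

section \<open>Orthogonal decomposition of simplicial chains\<close>

lemma linear_chain_inner: "linear (\<lambda>x. chain_inner x y)"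
  unfolding chain_inner_def
  by (rule linear_sum_over_keys) (auto intro!: linearI simp: algebra_simps)

lemma chain_inner_commute: "chain_inner x y = chain_inner y x"
proof -
  have "chain_inner x y = (\<Sum>\<sigma>\<in>Poly_Mapping.keys x \<union> Poly_Mapping.keys y.
      Poly_Mapping.lookup x \<sigma> * Poly_Mapping.lookup y \<sigma>)" for x y :: "'s \<Rightarrow>\<^sub>0 real"
    unfolding chain_inner_def by (intro sum.mono_neutral_left) (auto simp: in_keys_iff)
  from this[of x y] this[of y x] show ?thesis
    by (simp add: Un_commute mult.commute)
qed

lemma chain_inner_self_eq_0:
  assumes "chain_inner x x = 0"
  shows "x = 0"
proof -
  have "\<forall>\<sigma>\<in>Poly_Mapping.keys x. Poly_Mapping.lookup x \<sigma> * Poly_Mapping.lookup x \<sigma> = 0"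
    using assms unfolding chain_inner_def by (subst (asm) sum_nonneg_eq_0_iff) auto
  then show ?thesis
    by (auto simp: in_keys_iff intro: poly_mapping_eqI)
qed

lemma subspace_chain_orth: "subspace {y. chain_inner z y = 0}"
  unfolding chain_inner_commute[of z]
  using linear_subspace_vimage[OF linear_chain_inner[of z] subspace_single_0]
  by (simp add: vimage_def)

text \<open>
  The induction step is one step of the Gram-Schmidt process: with \<open>u\<close> the part of \<open>b\<close> orthogonal to the span of \<open>B\<close>, the
  projection to the larger span is corrected by a multiple of \<open>u\<close>.
\<close>

lemma orthogonal_decomposition_span:
  assumes "finite B"
  shows "\<exists>s\<in>span B. \<forall>y\<in>span B. chain_inner (x - s) y = 0"
  using assms
proof (induction B arbitrary: x)
  case empty
  then show ?case by (simp add: chain_inner_commute[of _ 0] linear_0[OF linear_chain_inner])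
next
  case (insert b B)
  obtain p where p: "p \<in> span B" "\<And>y. y \<in> span B \<Longrightarrow> chain_inner (b - p) y = 0"
    using insert.IH[of b] by auto
  obtain s where s: "s \<in> span B" "\<And>y. y \<in> span B \<Longrightarrow> chain_inner (x - s) y = 0"
    using insert.IH[of x] by auto
  define u where "u = b - p"
  \<comment> \<open>If \<open>b\<close> already lies in the span, then \<open>u = 0\<close>, division by zero gives \<open>k = 0\<close>, and \<open>s' = s\<close>.\<close>
  define k where "k = chain_inner (x - s) u / chain_inner u u"
  define s' where "s' = s + k *\<^sub>R u"
  have diff: "chain_inner (x - s') y = chain_inner (x - s) y - k * chain_inner u y" for y
    using linear_diff[OF linear_chain_inner[of y], of "x - s" "k *\<^sub>R u"]
      linear_scale[OF linear_chain_inner[of y], of k u]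
    by (simp add: s'_def algebra_simps)
  have orth: "chain_inner (x - s') y = 0" if "y \<in> span B" for y
    using p(2)[OF that] s(2)[OF that] by (simp add: diff u_def)
  have "chain_inner (x - s') u = 0"
  proof (cases "u = 0")
    case True
    then show ?thesis
      by (simp add: chain_inner_commute[of _ 0] linear_0[OF linear_chain_inner])
  next
    case False
    then have "chain_inner u u \<noteq> 0" using chain_inner_self_eq_0 by blast
    then show ?thesis by (simp add: diff k_def)
  qed
  then have "chain_inner (x - s') b = 0"
    using subspace_add[OF subspace_chain_orth, of u "x - s'" p] orth[OF p(1)] by (simp add: u_def)
  then have "insert b B \<subseteq> {y. chain_inner (x - s') y = 0}"
    using orth span_superset[of B] by auto
  then have "span (insert b B) \<subseteq> {y. chain_inner (x - s') y = 0}"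
    by (rule span_minimal) (rule subspace_chain_orth)
  moreover have "s' \<in> span (insert b B)"
  proof -
    have "s \<in> span (insert b B)" "p \<in> span (insert b B)" "b \<in> span (insert b B)"
      using s(1) p(1) span_mono[of B "insert b B"] span_base[of b] by auto
    then show ?thesis
      by (simp add: s'_def u_def span_add span_scale span_diff)
  qed
  ultimately show ?case by blast
qed

text \<open>
  The chains of a finite complex are spanned by its simplices, so any subspace of them has a
  finite basis, and the decomposition along a finite span applies.
\<close>

lemma orthogonal_decomposition:
  assumes "finite K" "subspace S" "S \<subseteq> simplicial_chains \<rho> K"
  obtains s where "s \<in> S" "\<And>y. y \<in> S \<Longrightarrow> chain_inner (x - s) y = 0"
proof -
  obtain B where B: "B \<subseteq> S" "independent B" "S \<subseteq> span B"
    using maximal_independent_subset by blast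
  let ?E = "(\<lambda>\<sigma>. Poly_Mapping.single \<sigma> (1::real)) ` K"
  have "c \<in> span ?E" if "c \<in> simplicial_chains \<rho> K" for c
  proof -
    have "c = (\<Sum>\<sigma>\<in>Poly_Mapping.keys c. Poly_Mapping.lookup c \<sigma> *\<^sub>R Poly_Mapping.single \<sigma> 1)"
      by (rule poly_mapping_eqI)
        (simp add: lookup_sum lookup_scaleR lookup_single when_def in_keys_iff
          if_distrib[of "(*) _"] cong: if_cong)
    also have "\<dots> \<in> span ?E"
      using that by (intro span_sum span_scale span_base) (auto simp: simplicial_chains_def)
    finally show ?thesis .
  qed
  then have "B \<subseteq> span ?E" using B(1) assms(3) by auto
  then have "finite B"
    using independent_span_bound[of ?E B] B(2) assms(1) by auto
  moreover have "span B = S"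
    using B assms(2) by (simp add: span_minimal subset_antisym)
  ultimately show ?thesis
    using orthogonal_decomposition_span[of B x] that by auto
qed

section \<open>Cosheaf chains on subcomplexes of the order complex\<close>

lemma chain_min_least:
  assumes "\<sigma> \<in> order_complex R"
  shows "chain_min \<sigma> \<in> \<sigma>" and "\<And>a. a \<in> \<sigma> \<Longrightarrow> chain_min \<sigma> \<le> a"
proof -
  obtain m where m: "m \<in> \<sigma>" "\<forall>a\<in>\<sigma>. a \<le> m \<longrightarrow> m = a"
    using assms finite_has_minimal[of \<sigma>] by (auto simp: order_complex_def)
  then have least: "m \<le> a" if "a \<in> \<sigma>" for a
  proof -
    have "a \<le> m \<or> m \<le> a" using assms that m(1) by (simp add: order_complex_def)
    then show ?thesis using m(2) that by auto
  qed
  then have "chain_min \<sigma> = m"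
    unfolding chain_min_def using m(1) by (intro Least_equality)
  then show "chain_min \<sigma> \<in> \<sigma>" "\<And>a. a \<in> \<sigma> \<Longrightarrow> chain_min \<sigma> \<le> a"
    using m(1) least by auto
qed

lemma chain_max_greatest:
  assumes "\<sigma> \<in> order_complex R"
  shows "chain_max \<sigma> \<in> \<sigma>" and "\<And>a. a \<in> \<sigma> \<Longrightarrow> a \<le> chain_max \<sigma>"
proof -
  obtain m where m: "m \<in> \<sigma>" "\<forall>a\<in>\<sigma>. m \<le> a \<longrightarrow> m = a"
    using assms finite_has_maximal[of \<sigma>] by (auto simp: order_complex_def)
  then have greatest: "a \<le> m" if "a \<in> \<sigma>" for a
  proof -
    have "a \<le> m \<or> m \<le> a" using assms that m(1) by (simp add: order_complex_def)
    then show ?thesis using m(2) that by auto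
  qed
  then have "chain_max \<sigma> = m"
    unfolding chain_max_def using m(1) by (intro Greatest_equality)
  then show "chain_max \<sigma> \<in> \<sigma>" "\<And>a. a \<in> \<sigma> \<Longrightarrow> a \<le> chain_max \<sigma>"
    using m(1) greatest by auto
qed

lemma singleton_in_order_complex_iff: "{a} \<in> order_complex R \<longleftrightarrow> a \<in> R"
  by (auto simp: order_complex_def)

lemma chain_min_singleton: "chain_min {a} = a" and chain_max_singleton: "chain_max {a} = a"
  using chain_min_least(1)[of "{a}" UNIV] chain_max_greatest(1)[of "{a}" UNIV]
  by (auto simp: singleton_in_order_complex_iff)

lemma face_in_order_complex:
  assumes "\<tau> \<in> order_complex R" "\<tau> - {a} \<noteq> {}"
  shows "\<tau> - {a} \<in> order_complex R"
    and "chain_min \<tau> \<le> chain_min (\<tau> - {a})" and "chain_max (\<tau> - {a}) \<le> chain_max \<tau>"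
proof -
  show face: "\<tau> - {a} \<in> order_complex R"
    using assms by (auto simp: order_complex_def)
  show "chain_min \<tau> \<le> chain_min (\<tau> - {a})" "chain_max (\<tau> - {a}) \<le> chain_max \<tau>"
    using chain_min_least(1)[OF face] chain_max_greatest(1)[OF face]
      chain_min_least(2)[OF assms(1)] chain_max_greatest(2)[OF assms(1)] by auto
qed

definition subcomplex_of_chains :: "'r::order set \<Rightarrow> 'r set set \<Rightarrow> bool" where
  "subcomplex_of_chains R L \<longleftrightarrow>
     L \<subseteq> order_complex R \<and> (\<forall>\<tau>\<in>L. \<forall>a. \<tau> - {a} \<noteq> {} \<longrightarrow> \<tau> - {a} \<in> L)"

lemma subcomplex_order_complex_le: "subcomplex_of_chains R (order_complex_le R r)"
  using face_in_order_complex order_trans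
  by (fastforce simp: subcomplex_of_chains_def order_complex_le_def)

lemma subcomplex_order_complex_less: "subcomplex_of_chains R (order_complex_less R r)"
  using face_in_order_complex le_less_trans
  by (fastforce simp: subcomplex_of_chains_def order_complex_less_def)

text \<open>
  Phrasing membership through nonzero coefficients, instead of the support, suits the vector
  space operations.
\<close>

lemma mem_cosheaf_chains_iff:
  "c \<in> cosheaf_chains N L s \<longleftrightarrow>
     (\<forall>\<sigma>. Poly_Mapping.lookup c \<sigma> \<noteq> 0 \<longrightarrow>
        \<sigma> \<in> L \<and> int (card \<sigma>) = s + 1 \<and> Poly_Mapping.lookup c \<sigma> \<in> N (chain_min \<sigma>))"
  by (auto simp: cosheaf_chains_def in_keys_iff)

locale subspace_functor =
  fixes R :: "'r::order set" and N :: "'r \<Rightarrow> 'w::real_vector set"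
  assumes finite_index: "finite R"
    and subspace: "\<And>a. a \<in> R \<Longrightarrow> subspace (N a)"
    and mono: "\<And>a a'. a \<in> R \<Longrightarrow> a' \<in> R \<Longrightarrow> a \<le> a' \<Longrightarrow> N a \<subseteq> N a'"
begin

lemma subspace_at_chain_min:
  assumes "\<sigma> \<in> order_complex R"
  shows "subspace (N (chain_min \<sigma>))"
  using chain_min_least(1)[OF assms] assms by (auto simp: order_complex_def intro!: subspace)

lemma subspace_cosheaf_chains:
  assumes "L \<subseteq> order_complex R"
  shows "subspace (cosheaf_chains N L s)"
proof (rule subspaceI)
  have N: "subspace (N (chain_min \<sigma>))" if "\<sigma> \<in> L" for \<sigma>
    using subspace_at_chain_min assms that by auto
  show "0 \<in> cosheaf_chains N L s"
    by (simp add: mem_cosheaf_chains_iff)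
  fix c d and k :: real
  assume c: "c \<in> cosheaf_chains N L s"
  show "k *\<^sub>R c \<in> cosheaf_chains N L s"
    using c subspace_scale[OF N] by (simp add: mem_cosheaf_chains_iff lookup_scaleR)
  assume d: "d \<in> cosheaf_chains N L s"
  show "c + d \<in> cosheaf_chains N L s"
    unfolding mem_cosheaf_chains_iff lookup_add
  proof (intro allI impI)
    fix \<sigma> assume "Poly_Mapping.lookup c \<sigma> + Poly_Mapping.lookup d \<sigma> \<noteq> 0"
    then have "Poly_Mapping.lookup c \<sigma> \<noteq> 0 \<or> Poly_Mapping.lookup d \<sigma> \<noteq> 0"
      by auto
    then have \<sigma>: "\<sigma> \<in> L" "int (card \<sigma>) = s + 1"
      using c d by (auto simp: mem_cosheaf_chains_iff)
    have "Poly_Mapping.lookup c \<sigma> \<in> N (chain_min \<sigma>)" "Poly_Mapping.lookup d \<sigma> \<in> N (chain_min \<sigma>)"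
      using c d subspace_0[OF N[OF \<sigma>(1)]] by (metis mem_cosheaf_chains_iff)+
    then show "\<sigma> \<in> L \<and> int (card \<sigma>) = s + 1 \<and>
        Poly_Mapping.lookup c \<sigma> + Poly_Mapping.lookup d \<sigma> \<in> N (chain_min \<sigma>)"
      using \<sigma> subspace_add[OF N[OF \<sigma>(1)]] by simp
  qed
qed

lemma single_in_cosheaf_chains:
  assumes "\<sigma> \<in> L" "int (card \<sigma>) = s + 1" "x \<in> N (chain_min \<sigma>)"
  shows "Poly_Mapping.single \<sigma> x \<in> cosheaf_chains N L s"
  using assms by (auto simp: mem_cosheaf_chains_iff lookup_single when_def)

text \<open>
  Deleting a vertex can only raise the minimum of a chain, and \<open>N\<close> is monotone, so a coefficient
  of a chain is admissible on each of its faces.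
\<close>

lemma cosheaf_boundary_in_chains:
  assumes L: "subcomplex_of_chains R L" and c: "c \<in> cosheaf_chains N L s"
  shows "cosheaf_boundary inclusion_maps \<epsilon> c \<in> cosheaf_chains N L (s - 1)"
proof -
  have sub: "subspace (cosheaf_chains N L (s - 1))"
    using L by (intro subspace_cosheaf_chains) (simp add: subcomplex_of_chains_def)
  have "Poly_Mapping.single (\<tau> - {a}) (k *\<^sub>R Poly_Mapping.lookup c \<tau>) \<in> cosheaf_chains N L (s - 1)"
    if \<tau>: "\<tau> \<in> Poly_Mapping.keys c" and a: "a \<in> \<tau>" "\<tau> - {a} \<noteq> {}" for \<tau> a and k :: real
  proof (rule single_in_cosheaf_chains)
    have "\<tau> \<in> L" and card: "int (card \<tau>) = s + 1" and x: "Poly_Mapping.lookup c \<tau> \<in> N (chain_min \<tau>)"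
      using c \<tau> by (auto simp: cosheaf_chains_def)
    then have oc: "\<tau> \<in> order_complex R"
      using L by (auto simp: subcomplex_of_chains_def)
    note face = face_in_order_complex[OF oc a(2)]
    show "\<tau> - {a} \<in> L"
      using L \<open>\<tau> \<in> L\<close> a(2) by (auto simp: subcomplex_of_chains_def)
    show "int (card (\<tau> - {a})) = s - 1 + 1"
    proof -
      have "finite \<tau>" using oc by (simp add: order_complex_def)
      then have "card \<tau> = Suc (card (\<tau> - {a}))" using a(1) by (rule card.remove)
      then show ?thesis using card by simp
    qed
    have "chain_min \<tau> \<in> R" "chain_min (\<tau> - {a}) \<in> R"
      using chain_min_least(1)[OF oc] chain_min_least(1)[OF face(1)] oc
      by (auto simp: order_complex_def)
    then have "Poly_Mapping.lookup c \<tau> \<in> N (chain_min (\<tau> - {a}))"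
      using mono[OF _ _ face(2)] x by auto
    then show "k *\<^sub>R Poly_Mapping.lookup c \<tau> \<in> N (chain_min (\<tau> - {a}))"
      by (rule subspace_scale[OF subspace_at_chain_min[OF face(1)]])
  qed
  then show ?thesis
    unfolding cosheaf_boundary_def inclusion_maps_def
    by (intro subspace_sum[OF sub]) auto
qed

section \<open>Chains relative to the part below an element\<close>

definition generated_below :: "'r \<Rightarrow> 'w set" where
  "generated_below r = (\<Sum>t\<in>{t \<in> R. t < r}. N t)"

lemma subspace_generated_below: "subspace (generated_below r)"
  unfolding generated_below_def by (rule subspace_sum_of_subspaces) (auto simp: finite_index subspace)

lemma in_generated_below:
  assumes "t \<in> R" "t < r" "x \<in> N t"
  shows "x \<in> generated_below r"
  using summand_subset_sum_of_subspaces[of "{t \<in> R. t < r}" N t] assms finite_index subspace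
  by (auto simp: generated_below_def)

lemma generated_below_subset:
  assumes "r \<in> R"
  shows "generated_below r \<subseteq> N r"
  unfolding generated_below_def using assms finite_index
  by (intro sum_of_subspaces_subset subspace mono) auto

lemma vertex_chain_support:
  assumes "c \<in> cosheaf_chains N (order_complex_le R r) 0" "Poly_Mapping.lookup c \<sigma> \<noteq> 0"
  obtains a where "\<sigma> = {a}" "a \<in> R" "a \<le> r"
proof -
  have "card \<sigma> = 1" and \<sigma>: "\<sigma> \<in> order_complex_le R r"
    using assms by (auto simp: mem_cosheaf_chains_iff)
  then obtain a where "\<sigma> = {a}" by (meson card_1_singletonE)
  with \<sigma> that show ?thesis
    by (auto simp: order_complex_le_def singleton_in_order_complex_iff chain_max_singleton)
qed

lemma cosheaf_chains_less_subset_le: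
  "cosheaf_chains N (order_complex_less R r) s \<subseteq> cosheaf_chains N (order_complex_le R r) s"
proof -
  have "order_complex_less R r \<subseteq> order_complex_le R r"
    by (auto simp: order_complex_le_def order_complex_less_def)
  then show ?thesis
    unfolding mem_cosheaf_chains_iff subset_iff by blast
qed

text \<open>
  A vertex at most \<open>r\<close> but not below \<open>r\<close> is \<open>r\<close> itself: this is the kernel of the coefficient at
  \<open>r\<close>, so the relative chains in degree 0 are isomorphic to \<open>N r\<close>.
\<close>

lemma vertex_chains_less_eq:
  "cosheaf_chains N (order_complex_less R r) 0 =
     {c \<in> cosheaf_chains N (order_complex_le R r) 0. Poly_Mapping.lookup c {r} = 0}"
proof (intro equalityI subsetI)
  fix c assume "c \<in> cosheaf_chains N (order_complex_less R r) 0"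
  moreover from this have "Poly_Mapping.lookup c {r} = 0"
    by (auto simp: mem_cosheaf_chains_iff order_complex_less_def chain_max_singleton)
  ultimately show "c \<in> {c \<in> cosheaf_chains N (order_complex_le R r) 0. Poly_Mapping.lookup c {r} = 0}"
    using cosheaf_chains_less_subset_le by blast
next
  fix c assume c: "c \<in> {c \<in> cosheaf_chains N (order_complex_le R r) 0. Poly_Mapping.lookup c {r} = 0}"
  have "\<sigma> \<in> order_complex_less R r" if nz: "Poly_Mapping.lookup c \<sigma> \<noteq> 0" for \<sigma>
  proof -
    obtain a where "\<sigma> = {a}" "a \<in> R" "a \<le> r"
      using vertex_chain_support[of c r \<sigma>] c nz by blast
    then show ?thesis
      using c nz by (auto simp: order_complex_less_def singleton_in_order_complex_iff
          chain_max_singleton order.strict_iff_order)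
  qed
  then show "c \<in> cosheaf_chains N (order_complex_less R r) 0"
    using c by (auto simp: mem_cosheaf_chains_iff)
qed

lemma linear_surjection_coefficient_at_top:
  assumes "r \<in> R"
  shows "linear_surjection (subspace_module (cosheaf_chains N (order_complex_le R r) 0))
    (subspace_module (N r)) (\<lambda>c. Poly_Mapping.lookup c {r})"
proof (rule linear_surjection_subspace_module)
  let ?C = "cosheaf_chains N (order_complex_le R r) 0"
  show "subspace ?C"
    by (rule subspace_cosheaf_chains) (auto simp: order_complex_le_def)
  show "(\<lambda>c. Poly_Mapping.lookup c {r}) ` ?C = N r"
  proof (intro equalityI subsetI)
    fix x assume "x \<in> (\<lambda>c. Poly_Mapping.lookup c {r}) ` ?C"
    then obtain c where "c \<in> ?C" "x = Poly_Mapping.lookup c {r}"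
      by blast
    then show "x \<in> N r"
      using subspace_0[OF subspace[OF assms]]
      by (cases "x = 0") (auto simp: mem_cosheaf_chains_iff chain_min_singleton)
  next
    fix x assume "x \<in> N r"
    then have "Poly_Mapping.single {r} x \<in> ?C"
      using assms by (intro single_in_cosheaf_chains)
        (auto simp: order_complex_le_def singleton_in_order_complex_iff chain_max_singleton
          chain_min_singleton)
    then show "x \<in> (\<lambda>c. Poly_Mapping.lookup c {r}) ` ?C"
      by (rule rev_image_eqI) simp
  qed
qed (auto simp: lookup_add lookup_scaleR subspace assms)

text \<open>
  Only edges \<open>{a, r}\<close> with \<open>a < r\<close> have \<open>r\<close> as a face, and their coefficients lie in \<open>N a\<close>.
\<close>

lemma edge_boundary_at_top:
  assumes c: "c \<in> cosheaf_chains N (order_complex_le R r) 1"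
  shows "Poly_Mapping.lookup (cosheaf_boundary inclusion_maps \<epsilon> c) {r} \<in> generated_below r"
proof -
  have "Poly_Mapping.lookup (Poly_Mapping.single (\<tau> - {a}) (k *\<^sub>R Poly_Mapping.lookup c \<tau>)) {r}
      \<in> generated_below r"
    if \<tau>: "\<tau> \<in> Poly_Mapping.keys c" and a: "a \<in> \<tau>" for \<tau> a and k :: real
  proof (cases "\<tau> - {a} = {r}")
    case True
    have oc: "\<tau> \<in> order_complex R" "chain_max \<tau> \<le> r"
      and x: "Poly_Mapping.lookup c \<tau> \<in> N (chain_min \<tau>)"
      using c \<tau> by (auto simp: cosheaf_chains_def order_complex_le_def)
    have "\<tau> = {a, r}" "a \<noteq> r" using True a by auto
    moreover have "a \<le> r"
      using chain_max_greatest(2)[OF oc(1) a] oc(2) by simp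
    ultimately have "chain_min \<tau> = a"
      using chain_min_least(1)[OF oc(1)] chain_min_least(2)[OF oc(1) a] by auto
    moreover have "a \<in> R" using oc(1) a by (auto simp: order_complex_def)
    ultimately have "Poly_Mapping.lookup c \<tau> \<in> generated_below r"
      using x \<open>a \<noteq> r\<close> \<open>a \<le> r\<close> by (intro in_generated_below[of a]) auto
    then show ?thesis
      using True subspace_scale[OF subspace_generated_below] by simp
  next
    case False
    then show ?thesis
      using subspace_0[OF subspace_generated_below] by (simp add: lookup_single when_def)
  qed
  then show ?thesis
    unfolding cosheaf_boundary_def inclusion_maps_def lookup_sum
    by (intro subspace_sum[OF subspace_generated_below]) auto
qed

text \<open>
  Conversely, an element of \<open>N t\<close> with \<open>t < r\<close> is realised by placing it on the edge \<open>{t, r}\<close>.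
\<close>

lemma generated_below_is_edge_boundary:
  assumes r: "r \<in> R" and \<epsilon>: "orientation (order_complex R) \<epsilon>" and y: "y \<in> generated_below r"
  obtains c where "c \<in> cosheaf_chains N (order_complex_le R r) 1"
    and "Poly_Mapping.lookup (cosheaf_boundary inclusion_maps \<epsilon> c) {r} = y"
proof -
  let ?C = "cosheaf_chains N (order_complex_le R r) 1"
  let ?T = "{t \<in> R. t < r}"
  let ?bd = "cosheaf_boundary inclusion_maps \<epsilon> :: ('r set \<Rightarrow>\<^sub>0 'w) \<Rightarrow> _"
  obtain s where s: "y = sum s ?T" "\<And>t. t \<in> ?T \<Longrightarrow> s t \<in> N t"
    using y finite_index by (auto simp: generated_below_def set_sum_alt)
  have "\<exists>e\<in>?C. Poly_Mapping.lookup (?bd e) {r} = s t" if "t \<in> ?T" for t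
  proof -
    let ?\<tau> = "{t, r}"
    \<comment> \<open>This is the incidence sign of \<open>{r}\<close> in the edge; its square is 1, so it cancels itself.\<close>
    let ?k = "\<epsilon> ?\<tau> * \<epsilon> {r} * face_sign ?\<tau> t"
    have t: "t \<in> R" "t < r" "t \<noteq> r" using that by auto
    have \<tau>: "?\<tau> \<in> order_complex R"
      using t r by (auto simp: order_complex_def)
    have min: "chain_min ?\<tau> = t"
      using chain_min_least[OF \<tau>] t by force
    have max: "chain_max ?\<tau> = r"
      using chain_max_greatest[OF \<tau>] t by force
    have "\<epsilon> ?\<tau> \<in> {1, -1}" "\<epsilon> {r} \<in> {1, -1}"
      using \<epsilon> \<tau> r by (auto simp: orientation_def Pi_iff singleton_in_order_complex_iff)
    moreover have "face_sign ?\<tau> t \<in> {1, -1}"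
      by (cases "even (card {u\<in>?\<tau>. u < t})") (auto simp: face_sign_def)
    ultimately have k: "?k * ?k = 1" by auto
    have "Poly_Mapping.single ?\<tau> (?k *\<^sub>R s t) \<in> ?C"
      using t s(2)[OF that] subspace_scale[OF subspace[OF t(1)]] \<tau> min max
      by (intro single_in_cosheaf_chains) (auto simp: order_complex_le_def)
    moreover have "Poly_Mapping.lookup (?bd (Poly_Mapping.single ?\<tau> (?k *\<^sub>R s t))) {r} = s t"
    proof -
      have "?bd (Poly_Mapping.single ?\<tau> x) = (\<Sum>a\<in>?\<tau>. Poly_Mapping.single (?\<tau> - {a})
          ((\<epsilon> ?\<tau> * \<epsilon> (?\<tau> - {a}) * face_sign ?\<tau> a) *\<^sub>R x))" for x
      proof -
        have "{a \<in> ?\<tau>. ?\<tau> - {a} \<noteq> {}} = ?\<tau>" using t by auto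
        then show ?thesis
          by (cases "x = 0") (simp_all add: cosheaf_boundary_def inclusion_maps_def)
      qed
      moreover have "?\<tau> - {t} = {r}" "?\<tau> - {r} = {t}" using t by auto
      ultimately show ?thesis
        using t(3) k by (simp add: lookup_add lookup_single when_def)
    qed
    ultimately show ?thesis by blast
  qed
  then obtain e where e: "\<And>t. t \<in> ?T \<Longrightarrow> e t \<in> ?C"
    "\<And>t. t \<in> ?T \<Longrightarrow> Poly_Mapping.lookup (?bd (e t)) {r} = s t"
    by metis
  have "sum e ?T \<in> ?C"
    by (intro subspace_sum subspace_cosheaf_chains e) (auto simp: order_complex_le_def)
  moreover have "Poly_Mapping.lookup (?bd (sum e ?T)) {r} = y"
    using e(2) by (simp add: linear_sum[OF linear_cosheaf_boundary] lookup_sum s(1))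
  ultimately show ?thesis using that by blast
qed


section \<open>Moebius homology in degree zero\<close>

lemma rel_boundary_coset:
  "rel_boundary R N inclusion_maps \<epsilon> r s
      ((\<lambda>n. n + c) ` cosheaf_chains N (order_complex_less R r) s)
    = (\<lambda>n. n + cosheaf_boundary inclusion_maps \<epsilon> c) ` cosheaf_chains N (order_complex_less R r) (s - 1)"
  unfolding rel_boundary_def
  by (intro quot_map_coset subspace_cosheaf_chains linear_cosheaf_boundary image_subsetI
      cosheaf_boundary_in_chains subcomplex_order_complex_less) (auto simp: order_complex_less_def)

lemma carrier_rel_chains:
  "carrier (rel_chains R N r s) =
    (\<lambda>c. (\<lambda>n. n + c) ` cosheaf_chains N (order_complex_less R r) s) `
      cosheaf_chains N (order_complex_le R r) s"
  by (simp add: rel_chains_def carrier_quot_subspace_module)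

lemma zero_rel_chains: "\<zero>\<^bsub>rel_chains R N r s\<^esub> = cosheaf_chains N (order_complex_less R r) s"
  by (simp add: rel_chains_def quot_module_def)

lemma cosheaf_chains_minus_1:
  assumes "L \<subseteq> order_complex R"
  shows "cosheaf_chains N L (- 1) = {0}"
proof -
  have "Poly_Mapping.lookup c \<sigma> = 0" if "c \<in> cosheaf_chains N L (- 1)" for c \<sigma>
  proof (rule ccontr)
    assume "Poly_Mapping.lookup c \<sigma> \<noteq> 0"
    then have "\<sigma> \<in> order_complex R" "card \<sigma> = 0"
      using that assms by (auto simp: mem_cosheaf_chains_iff)
    then show False by (auto simp: order_complex_def)
  qed
  then show ?thesis
    using subspace_0[OF subspace_cosheaf_chains[OF assms]] by (auto intro: poly_mapping_eqI)
qed

text \<open>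
  All relative 0-chains are cycles: a chain of the poset is nonempty, so there is nothing in
  degree -1.
\<close>

lemma kernel_rel_boundary_0:
  "a_kernel (rel_chains R N r 0) (rel_chains R N r (- 1)) (rel_boundary R N inclusion_maps \<epsilon> r 0)
    = carrier (rel_chains R N r 0)"
proof -
  have "rel_boundary R N inclusion_maps \<epsilon> r 0 X = \<zero>\<^bsub>rel_chains R N r (- 1)\<^esub>"
    if X: "X \<in> carrier (rel_chains R N r 0)" for X
  proof -
    obtain c where c: "c \<in> cosheaf_chains N (order_complex_le R r) 0"
      "X = (\<lambda>n. n + c) ` cosheaf_chains N (order_complex_less R r) 0"
      using X by (auto simp: carrier_rel_chains)
    have "cosheaf_boundary inclusion_maps \<epsilon> c \<in> cosheaf_chains N (order_complex_le R r) (- 1)"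
      using cosheaf_boundary_in_chains[OF subcomplex_order_complex_le c(1)] by simp
    moreover have "cosheaf_chains N (order_complex_le R r) (- 1) = {0}"
      by (rule cosheaf_chains_minus_1) (auto simp: order_complex_le_def)
    moreover have "cosheaf_chains N (order_complex_less R r) (- 1) = {0}"
      by (rule cosheaf_chains_minus_1) (auto simp: order_complex_less_def)
    ultimately show ?thesis
      using rel_boundary_coset[of \<epsilon> r 0 c] c(2) by (simp add: zero_rel_chains)
  qed
  then show ?thesis by (auto simp: a_kernel_def kernel_def)
qed

text \<open>
  The homology is \<open>N r / S\<close> with \<open>S = generated_below r\<close>. The isomorphism with a complement \<open>Q\<close> is
  induced by the coefficient at \<open>r\<close> followed by the projection onto \<open>Q\<close> along \<open>S\<close>; it remains to
  see that the kernel of this map consists exactly of the relative boundaries.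
\<close>

theorem moebius_homology_0_complement:
  assumes r: "r \<in> R" and \<epsilon>: "orientation (order_complex R) \<epsilon>"
    and Q: "subspace Q" "Q \<subseteq> N r" "Q \<inter> generated_below r = {0}"
      "\<And>x. x \<in> N r \<Longrightarrow> \<exists>q\<in>Q. x - q \<in> generated_below r"
  shows "vs_isomorphic (moebius_homology R N inclusion_maps \<epsilon> 0 r) (subspace_module Q)"
proof -
  let ?C = "cosheaf_chains N (order_complex_le R r)" and ?D = "cosheaf_chains N (order_complex_less R r)"
  let ?bd = "cosheaf_boundary inclusion_maps \<epsilon> :: ('r set \<Rightarrow>\<^sub>0 'w) \<Rightarrow> _"
  let ?top = "\<lambda>c :: 'r set \<Rightarrow>\<^sub>0 'w. Poly_Mapping.lookup c {r}"
  define \<phi> where "\<phi> = (\<lambda>X. the_elem (?top ` X))"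
  have D: "?D 0 = {c \<in> carrier (subspace_module (?C 0)). ?top c = \<zero>\<^bsub>subspace_module (N r)\<^esub>}"
    using vertex_chains_less_eq by simp
  note top = linear_surjection_quot_kernel[OF linear_surjection_coefficient_at_top[OF r] D,
      folded rel_chains_def \<phi>_def]
  have \<phi>_coset: "\<phi> ((\<lambda>n. n + c) ` ?D 0) = ?top c" if "c \<in> ?C 0" for c
    using top(3)[of c] that by (simp add: coset_subspace_module \<phi>_def)
  obtain \<pi> where \<pi>: "linear_surjection (subspace_module (N r)) (subspace_module Q) \<pi>"
    and \<pi>_0: "\<And>x. x \<in> N r \<Longrightarrow> \<pi> x = 0 \<longleftrightarrow> x \<in> generated_below r"
    using projection_along[OF subspace[OF r] Q(1,2) subspace_generated_below Q(3,4)] by blast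
  have surj: "linear_surjection (rel_chains R N r 0) (subspace_module Q) (\<pi> \<circ> \<phi>)"
    by (rule linear_surjection_comp[OF top(1) \<pi>])
  have \<phi>_in: "\<phi> X \<in> N r" if "X \<in> carrier (rel_chains R N r 0)" for X
    using top(1) that by (auto simp: linear_surjection_def)
  have bd_in: "?bd c \<in> ?C 0" if "c \<in> ?C 1" for c
    using cosheaf_boundary_in_chains[OF subcomplex_order_complex_le that] by simp
  have bd_coset: "rel_boundary R N inclusion_maps \<epsilon> r 1 ((\<lambda>n. n + c) ` ?D 1) = (\<lambda>n. n + ?bd c) ` ?D 0"
    for c
    using rel_boundary_coset[of \<epsilon> r 1 c] by simp
  have "rel_boundary R N inclusion_maps \<epsilon> r 1 ` carrier (rel_chains R N r 1) =
      {X \<in> carrier (rel_chains R N r 0). (\<pi> \<circ> \<phi>) X = \<zero>\<^bsub>subspace_module Q\<^esub>}"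
  proof (intro equalityI subsetI)
    fix X
    assume "X \<in> rel_boundary R N inclusion_maps \<epsilon> r 1 ` carrier (rel_chains R N r 1)"
    then obtain c where c: "c \<in> ?C 1" and X: "X = (\<lambda>n. n + ?bd c) ` ?D 0"
      by (auto simp: carrier_rel_chains bd_coset)
    have X_in: "X \<in> carrier (rel_chains R N r 0)"
      using bd_in[OF c] X by (auto simp: carrier_rel_chains)
    have "\<phi> X \<in> generated_below r"
      using edge_boundary_at_top[OF c] \<phi>_coset[OF bd_in[OF c]] X by simp
    then show "X \<in> {X \<in> carrier (rel_chains R N r 0). (\<pi> \<circ> \<phi>) X = \<zero>\<^bsub>subspace_module Q\<^esub>}"
      using X_in \<pi>_0[OF \<phi>_in[OF X_in]] by simp
  next
    fix X
    assume "X \<in> {X \<in> carrier (rel_chains R N r 0). (\<pi> \<circ> \<phi>) X = \<zero>\<^bsub>subspace_module Q\<^esub>}"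
    then have X_in: "X \<in> carrier (rel_chains R N r 0)" and "\<phi> X \<in> generated_below r"
      using \<pi>_0 \<phi>_in by auto
    then obtain c where c: "c \<in> ?C 1" "?top (?bd c) = \<phi> X"
      using generated_below_is_edge_boundary[OF r \<epsilon>] by metis
    \<comment> \<open>The coefficient at \<open>r\<close> determines a relative 0-chain, so \<open>X\<close> is the boundary of \<open>c\<close>.\<close>
    have "\<phi> X = \<phi> ((\<lambda>n. n + ?bd c) ` ?D 0)"
      using \<phi>_coset[OF bd_in[OF c(1)]] c(2) by simp
    then have "X = (\<lambda>n. n + ?bd c) ` ?D 0"
      using X_in bd_in[OF c(1)] by (intro inj_onD[OF top(2)]) (auto simp: carrier_rel_chains)
    then show "X \<in> rel_boundary R N inclusion_maps \<epsilon> r 1 ` carrier (rel_chains R N r 1)"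
      using c(1) bd_coset[of c] by (auto simp: carrier_rel_chains)
  qed
  note image = this
  have "moebius_homology R N inclusion_maps \<epsilon> 0 r = quot_module (rel_chains R N r 0)
      {X \<in> carrier (rel_chains R N r 0). (\<pi> \<circ> \<phi>) X = \<zero>\<^bsub>subspace_module Q\<^esub>}"
    by (simp add: moebius_homology_def homology_at_def kernel_rel_boundary_0 image del: comp_apply)
  then show ?thesis
    using vs_isomorphic_if_injective_linear_surjection[OF
        linear_surjection_quot_kernel(1,2)[OF surj refl]] by (simp only:)
qed

end

section \<open>Birth-death spaces\<close>

lemma subspace_simplicial_chains: "subspace (simplicial_chains \<rho> L)"
proof -
  have "simplicial_chains \<rho> L =
      {c. \<forall>\<sigma>. \<not> (\<sigma> \<in> L \<and> card \<sigma> = Suc \<rho>) \<longrightarrow> Poly_Mapping.lookup c \<sigma> = 0}"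
    by (auto simp: simplicial_chains_def in_keys_iff)
  then show ?thesis
    by (simp add: subspace_def lookup_add lookup_scaleR)
qed

lemma subspace_cycles: "subspace (cycles \<rho> L)"
proof -
  have "cycles \<rho> L = simplicial_chains \<rho> L \<inter> simplicial_boundary -` {0}"
    by (auto simp: cycles_def)
  then show ?thesis
    by (simp add: subspace_inter subspace_simplicial_chains linear_subspace_vimage
        linear_simplicial_boundary subspace_single_0)
qed

lemma subspace_boundaries: "subspace (boundaries \<rho> L)"
  unfolding boundaries_def
  by (intro linear_subspace_image linear_simplicial_boundary subspace_simplicial_chains)

lemma subspace_ZB:
  assumes "s \<in> Seg P"
  shows "subspace (ZB \<rho> F s)"
  using assms by (auto simp: Seg_def subspace_cycles subspace_boundaries subspace_inter)

lemma simplicial_chains_mono: "L \<subseteq> L' \<Longrightarrow> simplicial_chains \<rho> L \<subseteq> simplicial_chains \<rho> L'"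
  by (auto simp: simplicial_chains_def)

lemma cycles_mono: "L \<subseteq> L' \<Longrightarrow> cycles \<rho> L \<subseteq> cycles \<rho> L'"
  using simplicial_chains_mono[of L L' \<rho>] by (auto simp: cycles_def)

lemma boundaries_mono: "L \<subseteq> L' \<Longrightarrow> boundaries \<rho> L \<subseteq> boundaries \<rho> L'"
  unfolding boundaries_def by (intro image_mono simplicial_chains_mono)

lemma ZB_mono:
  assumes F: "filtration P K F" and s: "s \<in> Seg P" "t \<in> Seg P" "s \<le> t"
  shows "ZB \<rho> F s \<subseteq> ZB \<rho> F t"
proof -
  have F_le: "F a \<subseteq> F a'" if "a \<in> P" "a' \<in> P" "a \<le> a'" for a a'
    using F that by (auto simp: filtration_def mono_on_def)
  obtain b e b' e' where st: "s = (b, e)" "t = (b', e')"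
    by (cases s, cases t)
  then have cycles: "cycles \<rho> (F b) \<subseteq> cycles \<rho> (F b')"
    using s by (intro cycles_mono F_le) (auto simp: Seg_def)
  have "e \<noteq> Minf" "e' \<noteq> Minf"
    using s st by (auto simp: Seg_def)
  then consider d d' where "e = Fin d" "e' = Fin d'" | "e' = Pinf"
    using s st by (cases e; cases e') auto
  then show ?thesis
  proof cases
    case 1
    then have "boundaries \<rho> (F d) \<subseteq> boundaries \<rho> (F d')"
      using s st by (intro boundaries_mono F_le) (auto simp: Seg_def)
    then show ?thesis
      using cycles unfolding st 1 ZB.simps by (intro Int_mono)
  next
    case 2
    have "ZB \<rho> F s \<subseteq> cycles \<rho> (F b)"
      using \<open>e \<noteq> Minf\<close> st by (cases e) auto
    then show ?thesis
      using cycles unfolding st 2 by simp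
  qed
qed

lemma ZB_subset_chains:
  assumes "filtration P K F" and "s \<in> Seg P"
  shows "ZB \<rho> F s \<subseteq> simplicial_chains \<rho> K"
proof -
  have "cycles \<rho> (F a) \<subseteq> simplicial_chains \<rho> K" if "a \<in> P" for a
    using assms(1) that simplicial_chains_mono[of "F a" K]
    by (auto simp: filtration_def SubCx_def Pi_iff cycles_def)
  moreover obtain a e where "s = (a, e)" "a \<in> P" "e \<noteq> Minf"
    using assms(2) by (auto simp: Seg_def)
  moreover from this have "ZB \<rho> F s \<subseteq> cycles \<rho> (F a)"
    by (cases e) auto
  ultimately show ?thesis by blast
qed

lemma finite_Seg:
  assumes "finite P"
  shows "finite (Seg P)"
proof (rule finite_subset)
  show "Seg P \<subseteq> P \<times> insert Pinf (Fin ` P)" by (auto simp: Seg_def)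
qed (use assms in simp)

lemma subspace_chain_orth_comp: "subspace (chain_orth_comp \<rho> K W)"
proof -
  have "chain_orth_comp \<rho> K W = simplicial_chains \<rho> K \<inter> (\<Inter>y\<in>W. {x. chain_inner y x = 0})"
    by (auto simp: chain_orth_comp_def chain_inner_commute)
  then show ?thesis
    by (auto intro!: subspace_inter subspace_simplicial_chains subspace_Inter subspace_chain_orth)
qed

theorem theorem9:
  fixes P :: "'p::order set"
    and K :: "'v::linorder set set"
    and F :: "'p \<Rightarrow> 'v set set"
    and \<rho> :: nat
    and \<epsilon> :: "('p \<times> 'p extended) set \<Rightarrow> real"
    and b :: 'p
    and d :: "'p extended"
  assumes "finite P"
    and "finite_complex K"
    and "filtration P K F"
    and "orientation (order_complex (Seg P)) \<epsilon>"
    and "(b, d) \<in> Seg P"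
  shows "vs_isomorphic
           (moebius_homology (Seg P) (ZB \<rho> F) inclusion_maps \<epsilon> 0 (b, d))
           (subspace_module (orth_inverse P K \<rho> F (b, d)))"
proof -
  \<comment> \<open>It suffices that the orthogonal inverse is a complement of the sum of the smaller spaces.\<close>
  interpret subspace_functor "Seg P" "ZB \<rho> F"
    using assms(1,3) by unfold_locales (auto intro: finite_Seg subspace_ZB dest: ZB_mono)
  let ?S = "generated_below (b, d)" and ?Q = "orth_inverse P K \<rho> F (b, d)"
  have Q: "?Q = ZB \<rho> F (b, d) \<inter> chain_orth_comp \<rho> K ?S"
    by (simp add: orth_inverse_def generated_below_def)
  have S_sub: "?S \<subseteq> ZB \<rho> F (b, d)"
    by (rule generated_below_subset[OF assms(5)])
  have chains: "ZB \<rho> F (b, d) \<subseteq> simplicial_chains \<rho> K"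
    by (rule ZB_subset_chains[OF assms(3,5)])
  show ?thesis
  proof (rule moebius_homology_0_complement[OF assms(5,4)])
    show "subspace ?Q"
      unfolding Q by (intro subspace_inter subspace assms(5) subspace_chain_orth_comp)
    show "?Q \<subseteq> ZB \<rho> F (b, d)"
      by (simp add: Q)
    show "?Q \<inter> ?S = {0}"
    proof (intro equalityI subsetI)
      fix x assume "x \<in> ?Q \<inter> ?S"
      then have "chain_inner x x = 0"
        by (auto simp: Q chain_orth_comp_def)
      then show "x \<in> {0}"
        using chain_inner_self_eq_0 by auto
    qed (use subspace_0[OF \<open>subspace ?Q\<close>] subspace_0[OF subspace_generated_below] in auto)
    fix x assume x: "x \<in> ZB \<rho> F (b, d)"
    have "finite K" using assms(2) by (simp add: finite_complex_def)
    then obtain s where s: "s \<in> ?S" "\<And>y. y \<in> ?S \<Longrightarrow> chain_inner (x - s) y = 0"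
      using orthogonal_decomposition[OF _ subspace_generated_below, of K "(b, d)" \<rho> x] S_sub chains
      by blast
    have "x - s \<in> ZB \<rho> F (b, d)"
      using x s(1) S_sub subspace_diff[OF subspace[OF assms(5)]] by blast
    then have "x - s \<in> ?Q"
      using s(2) chains by (auto simp: Q chain_orth_comp_def)
    then show "\<exists>q\<in>?Q. x - q \<in> ?S"
      using s(1) by (intro bexI[of _ "x - s"]) auto
  qed
qed

end
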